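(* Let $X$ and $Y$ be normed spaces, $f:X\to Y$ and $\bar x\in X$. Suppose that the directional derivatives $f'(x;x-\bar x)$ and $f'(x;\bar x-x)$ exist for all $x\ne\bar x$ near $\bar x$, and $$\lim_{\bar x\ne x\to\bar x}\frac{\max\{\|f(x)-f(\bar x)-f'(x;x-\bar x)\|,\ \|f(x)-f(\bar x)+f'(x;\bar x-x)\|\}}{\|(f(x)-f(\bar x),\,x-\bar x)\|}=0.$$ Then $f$ is semismooth* at $\bar x$.
   Context: Directional derivative: $f'(x;h)=\lim_{t\downarrow0}\frac{f(x+th)-f(x)}{t}$ (limit in the norm of $Y$). Products of primal spaces carry the sum norm (so $\|(f(x)-f(\bar x),x-\bar x)\|=\|f(x)-f(\bar x)\|+\|x-\bar x\|$), and products of dual spaces the maximum norm. For a subset $\Omega$ of a normed space $Z$, $z\in\Omega$ and $\varepsilon\ge0$, the set of Fréchet $\varepsilon$-normals is $N_{\Omega,\varepsilon}(z)=\{z^*\in Z^*: \limsup_{\Omega\ni w\to z,\,w\ne z}\frac{\langle z^*,w-z\rangle}{\|w-z\|}\le\varepsilon\}$. $\Omega$ is semismooth* at $\bar z\in\Omega$ if for every $\varepsilon>0$ there is $\delta>0$ such that $|\langle z^*,z-\bar z\rangle|\le\varepsilon\|z-\bar z\|$ for all $z\in\Omega$ with $\|z-\bar z\|<\delta$ and all $z^*\in N_{\Omega,\delta}(z)$ with $\|z^*\|=1$. A function $f:X\to Y$ is semismooth* at $\bar x$ if $\mathrm{gph} f\subset X\times Y$ is semismooth* at $(\bar x,f(\bar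 x))$. *)

theory Defs
  imports "HOL-Analysis.Analysis"
begin

text \<open>The library equips the product type \<^typ>\<open>'a \<times> 'b\<close> with the Euclidean norm. Since
  \<open>\<epsilon>\<close>-normals depend on the norm, products with the sum norm get a type of their own.\<close>

datatype ('a, 'b) sum_prod = SPair (sfst: 'a) (ssnd: 'b)

instantiation sum_prod :: (real_vector, real_vector) real_vector
begin

definition zero_sum_prod :: "('a, 'b) sum_prod" where
  "0 = SPair 0 0"

definition plus_sum_prod :: "('a, 'b) sum_prod \<Rightarrow> ('a, 'b) sum_prod \<Rightarrow> ('a, 'b) sum_prod" where
  "p + q = SPair (sfst p + sfst q) (ssnd p + ssnd q)"

definition minus_sum_prod :: "('a, 'b) sum_prod \<Rightarrow> ('a, 'b) sum_prod \<Rightarrow> ('a, 'b) sum_prod" where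
  "p - q = SPair (sfst p - sfst q) (ssnd p - ssnd q)"

definition uminus_sum_prod :: "('a, 'b) sum_prod \<Rightarrow> ('a, 'b) sum_prod" where
  "- p = SPair (- sfst p) (- ssnd p)"

definition scaleR_sum_prod :: "real \<Rightarrow> ('a, 'b) sum_prod \<Rightarrow> ('a, 'b) sum_prod" where
  "scaleR r p = SPair (r *\<^sub>R sfst p) (r *\<^sub>R ssnd p)"

instance
  by standard
    (auto simp: zero_sum_prod_def plus_sum_prod_def minus_sum_prod_def uminus_sum_prod_def
      scaleR_sum_prod_def algebra_simps)

end

instantiation sum_prod :: (real_normed_vector, real_normed_vector) real_normed_vector
begin

definition norm_sum_prod :: "('a, 'b) sum_prod \<Rightarrow> real" where
  "norm_sum_prod p = norm (sfst p) + norm (ssnd p)"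

definition dist_sum_prod :: "('a, 'b) sum_prod \<Rightarrow> ('a, 'b) sum_prod \<Rightarrow> real" where
  "dist_sum_prod p q = norm (p - q)"

definition sgn_sum_prod :: "('a, 'b) sum_prod \<Rightarrow> ('a, 'b) sum_prod" where
  "sgn_sum_prod p = p /\<^sub>R norm p"

definition uniformity_sum_prod :: "(('a, 'b) sum_prod \<times> ('a, 'b) sum_prod) filter" where
  "uniformity_sum_prod = (INF e\<in>{0<..}. principal {(p, q). dist p q < e})"

definition open_sum_prod :: "('a, 'b) sum_prod set \<Rightarrow> bool" where
  "open_sum_prod U \<longleftrightarrow> (\<forall>p\<in>U. eventually (\<lambda>(p', q). p' = p \<longrightarrow> q \<in> U) uniformity)"

instance
proof
  fix p q :: "('a, 'b) sum_prod" and r :: real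
  show "norm p = 0 \<longleftrightarrow> p = 0"
    by (cases p) (auto simp: norm_sum_prod_def zero_sum_prod_def add_nonneg_eq_0_iff)
  show "norm (p + q) \<le> norm p + norm q"
    using norm_triangle_ineq[of "sfst p" "sfst q"] norm_triangle_ineq[of "ssnd p" "ssnd q"]
    by (simp add: norm_sum_prod_def plus_sum_prod_def)
  show "norm (r *\<^sub>R p) = \<bar>r\<bar> * norm p"
    by (simp add: norm_sum_prod_def scaleR_sum_prod_def distrib_left)
qed (simp_all add: dist_sum_prod_def sgn_sum_prod_def uniformity_sum_prod_def open_sum_prod_def)

end

text \<open>The operator norm on the dual of the sum-norm product is the maximum norm under the
  identification of a functional with its two components.\<close>

lemma norm_dual_sum_prod:
  fixes \<phi> :: "('a::real_normed_vector, 'b::real_normed_vector) sum_prod \<Rightarrow>\<^sub>L real"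
    and \<xi> :: "'a \<Rightarrow>\<^sub>L real" and \<eta> :: "'b \<Rightarrow>\<^sub>L real"
  assumes \<phi>: "\<And>x y. blinfun_apply \<phi> (SPair x y) = blinfun_apply \<xi> x + blinfun_apply \<eta> y"
  shows "norm \<phi> = max (norm \<xi>) (norm \<eta>)"
proof (rule antisym)
  show "norm \<phi> \<le> max (norm \<xi>) (norm \<eta>)"
  proof (rule norm_blinfun_bound)
    fix p :: "('a, 'b) sum_prod"
    obtain x y where p: "p = SPair x y" by (cases p)
    have "norm (\<phi> p) \<le> norm (\<xi> x) + norm (\<eta> y)"
      unfolding p \<phi> by (rule norm_triangle_ineq)
    also have "\<dots> \<le> norm \<xi> * norm x + norm \<eta> * norm y"
      by (intro add_mono norm_blinfun)
    also have "\<dots> \<le> max (norm \<xi>) (norm \<eta>) * norm x + max (norm \<xi>) (norm \<eta>) * norm y"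
      by (intro add_mono mult_right_mono) auto
    finally show "norm (\<phi> p) \<le> max (norm \<xi>) (norm \<eta>) * norm p"
      by (simp add: p norm_sum_prod_def distrib_left)
  qed (simp add: le_max_iff_disj)
  have "norm \<xi> \<le> norm \<phi>"
  proof (rule norm_blinfun_bound)
    show "norm (\<xi> x) \<le> norm \<phi> * norm x" for x
      using norm_blinfun[of \<phi> "SPair x 0"] \<phi>[of x 0]
      by (simp add: norm_sum_prod_def blinfun.zero_right)
  qed simp
  moreover have "norm \<eta> \<le> norm \<phi>"
  proof (rule norm_blinfun_bound)
    show "norm (\<eta> y) \<le> norm \<phi> * norm y" for y
      using norm_blinfun[of \<phi> "SPair 0 y"] \<phi>[of 0 y]
      by (simp add: norm_sum_prod_def blinfun.zero_right)
  qed simp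
  ultimately show "max (norm \<xi>) (norm \<eta>) \<le> norm \<phi>" by simp
qed

definition has_dir_deriv ::
    "('a::real_normed_vector \<Rightarrow> 'b::real_normed_vector) \<Rightarrow> 'a \<Rightarrow> 'a \<Rightarrow> 'b \<Rightarrow> bool" where
  "has_dir_deriv f x h v \<longleftrightarrow>
     ((\<lambda>t. (f (x + t *\<^sub>R h) - f x) /\<^sub>R t) \<longlongrightarrow> v) (at_right 0)"

definition dir_deriv_exists ::
    "('a::real_normed_vector \<Rightarrow> 'b::real_normed_vector) \<Rightarrow> 'a \<Rightarrow> 'a \<Rightarrow> bool" where
  "dir_deriv_exists f x h \<longleftrightarrow> (\<exists>v. has_dir_deriv f x h v)"

text \<open>An arbitrary value if the limit does not exist.\<close>

definition dir_deriv ::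
    "('a::real_normed_vector \<Rightarrow> 'b::real_normed_vector) \<Rightarrow> 'a \<Rightarrow> 'a \<Rightarrow> 'b" where
  "dir_deriv f x h = (THE v. has_dir_deriv f x h v)"

text \<open>The limit superior is taken in the extended reals; at an isolated point of \<open>\<Omega>\<close> the filter
  is trivial and the limit superior is \<open>-\<infinity>\<close>, so every functional is a normal there.\<close>

definition frechet_normals ::
    "'z::real_normed_vector set \<Rightarrow> real \<Rightarrow> 'z \<Rightarrow> ('z \<Rightarrow>\<^sub>L real) set" where
  "frechet_normals \<Omega> \<epsilon> z =
     {zs. Limsup (at z within \<Omega>) (\<lambda>w. ereal (blinfun_apply zs (w - z) / norm (w - z))) \<le> ereal \<epsilon>}"

definition semismooth_star_set :: "'z::real_normed_vector set \<Rightarrow> 'z \<Rightarrow> bool" where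
  "semismooth_star_set \<Omega> zbar \<longleftrightarrow> zbar \<in> \<Omega> \<and>
     (\<forall>\<epsilon>>0. \<exists>\<delta>>0. \<forall>z\<in>\<Omega>. norm (z - zbar) < \<delta> \<longrightarrow>
        (\<forall>zs\<in>frechet_normals \<Omega> \<delta> z. norm zs = 1 \<longrightarrow>
           \<bar>blinfun_apply zs (z - zbar)\<bar> \<le> \<epsilon> * norm (z - zbar)))"

definition gph :: "('a \<Rightarrow> 'b) \<Rightarrow> ('a, 'b) sum_prod set" where
  "gph f = {SPair x (f x) | x. True}"

definition semismooth_star ::
    "('a::real_normed_vector \<Rightarrow> 'b::real_normed_vector) \<Rightarrow> 'a \<Rightarrow> bool" where
  "semismooth_star f xbar \<longleftrightarrow> semismooth_star_set (gph f) (SPair xbar (f xbar))"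

end

theory Submission
  imports Defs
begin

text \<open>A Frechet \<open>\<epsilon>\<close>-normal \<open>\<zeta>\<close> to \<open>\<Omega>\<close> at \<open>z\<close> satisfies \<open>\<zeta> w \<le> \<epsilon> * norm w\<close> for every right-hand velocity
  \<open>w\<close> of a curve that starts at \<open>z\<close> and runs in \<open>\<Omega>\<close> (\<open>frechet_normal_velocity_le\<close>). On the graph of
  \<open>f\<close>, a directional derivative \<open>v\<close> of \<open>f\<close> at \<open>x\<close> in direction \<open>h\<close> yields the velocity \<open>(h, v)\<close>.
  The two directions \<open>h = x - xbar\<close> and \<open>h = xbar - x\<close> therefore give velocities which, by the limit
  assumption, differ from \<open>z - zbar\<close> and \<open>zbar - z\<close>, where \<open>z = (x, f x)\<close> and
  \<open>zbar = (xbar, f xbar)\<close>, by errors that are small relative to \<open>norm (z - zbar)\<close>. A functional of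
  norm 1 transfers such an error to its value without magnifying it, so the one-sided bounds at the
  two velocities become bounds for \<open>\<zeta> (z - zbar)\<close> and \<open>- \<zeta> (z - zbar)\<close>, that is, the two-sided
  bound of semismoothness*.\<close>

lemma tendsto_SPair:
  assumes "(g \<longlongrightarrow> a) F" and "(k \<longlongrightarrow> b) F"
  shows "((\<lambda>t. SPair (g t) (k t)) \<longlongrightarrow> SPair a b) F"
proof -
  have "((\<lambda>t. norm (g t - a) + norm (k t - b)) \<longlongrightarrow> 0 + 0) F"
    using assms by (intro tendsto_add tendsto_norm_zero LIM_zero)
  then have "((\<lambda>t. norm (SPair (g t) (k t) - SPair a b)) \<longlongrightarrow> 0) F"
    by (simp add: norm_sum_prod_def minus_sum_prod_def)
  then show ?thesis
    by (rule LIM_zero_cancel[OF tendsto_norm_zero_cancel])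
qed

text \<open>Along the curve, the quotient in the definition of a normal is unchanged when the increment is
  divided by \<open>t > 0\<close>, so it converges to \<open>\<zeta> w / norm w\<close>. Only \<open>w \<noteq> 0\<close> has to be considered, and then
  the curve leaves \<open>z\<close> at once, as the punctured limit superior requires.\<close>

lemma frechet_normal_velocity_le:
  fixes c :: "real \<Rightarrow> 'z::real_normed_vector"
  assumes normal: "\<zeta> \<in> frechet_normals \<Omega> \<epsilon> z"
    and velocity: "((\<lambda>t. (c t - z) /\<^sub>R t) \<longlongrightarrow> w) (at_right 0)"
    and in_\<Omega>: "\<forall>\<^sub>F t in at_right 0. c t \<in> \<Omega>"
  shows "blinfun_apply \<zeta> w \<le> \<epsilon> * norm w"
proof (cases "w = 0")
  case True
  then show ?thesis by (simp add: blinfun.zero_right)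
next
  case False
  define q where "q = (\<lambda>t. (c t - z) /\<^sub>R t)"
  have q: "(q \<longlongrightarrow> w) (at_right 0)"
    using velocity by (simp add: q_def)
  have pos: "\<forall>\<^sub>F t in at_right 0. (0::real) < t"
    by (rule eventually_at_right_less)
  have "((\<lambda>t. z + t *\<^sub>R q t) \<longlongrightarrow> z + 0 *\<^sub>R w) (at_right 0)"
    by (intro tendsto_intros q)
  moreover have "\<forall>\<^sub>F t in at_right 0. z + t *\<^sub>R q t = c t"
    using pos by eventually_elim (simp add: q_def)
  ultimately have "(c \<longlongrightarrow> z + 0 *\<^sub>R w) (at_right 0)"
    by (rule Lim_transform_eventually)
  then have "(c \<longlongrightarrow> z) (at_right 0)"
    by simp
  moreover have "\<forall>\<^sub>F t in at_right 0. c t \<in> \<Omega> \<and> c t \<noteq> z"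
    using in_\<Omega> tendsto_imp_eventually_ne[OF q False]
    by eventually_elim (auto simp: q_def)
  ultimately have c: "filterlim c (at z within \<Omega>) (at_right 0)"
    by (simp add: filterlim_at)
  have "\<zeta> w / norm w \<le> r" if "\<epsilon> < r" for r
  proof -
    have "Limsup (at z within \<Omega>) (\<lambda>u. ereal (\<zeta> (u - z) / norm (u - z))) < ereal r"
      using normal that unfolding frechet_normals_def by (auto intro: le_less_trans)
    then have "\<forall>\<^sub>F u in at z within \<Omega>. \<zeta> (u - z) / norm (u - z) < r"
      by (auto dest: Limsup_lessD)
    then have "\<forall>\<^sub>F t in at_right 0. \<zeta> (c t - z) / norm (c t - z) < r"
      using c by (rule eventually_compose_filterlim)
    then have "\<forall>\<^sub>F t in at_right 0. \<zeta> (q t) / norm (q t) \<le> r"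
      using pos by eventually_elim (simp add: q_def blinfun.scaleR_right)
    moreover have "((\<lambda>t. \<zeta> (q t) / norm (q t)) \<longlongrightarrow> \<zeta> w / norm w) (at_right 0)"
      using False by (intro tendsto_intros q) auto
    ultimately show ?thesis
      by (intro tendsto_upperbound[where F = "at_right (0::real)"]) auto
  qed
  then have "\<zeta> w / norm w \<le> \<epsilon>"
    by (rule dense_ge)
  then show ?thesis
    using False by (simp add: divide_le_eq)
qed

lemma frechet_normal_gph_le:
  assumes normal: "\<zeta> \<in> frechet_normals (gph f) \<epsilon> (SPair x (f x))"
    and deriv: "has_dir_deriv f x h v"
  shows "blinfun_apply \<zeta> (SPair h v) \<le> \<epsilon> * norm (SPair h v)"
proof -
  let ?c = "\<lambda>t. SPair (x + t *\<^sub>R h) (f (x + t *\<^sub>R h))"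
  have "((\<lambda>t. SPair h ((f (x + t *\<^sub>R h) - f x) /\<^sub>R t)) \<longlongrightarrow> SPair h v) (at_right 0)"
    using deriv unfolding has_dir_deriv_def by (intro tendsto_SPair tendsto_const)
  moreover have "\<forall>\<^sub>F t in at_right 0.
      SPair h ((f (x + t *\<^sub>R h) - f x) /\<^sub>R t) = (?c t - SPair x (f x)) /\<^sub>R t"
    using eventually_at_right_less[of "0::real"]
    by eventually_elim (simp add: minus_sum_prod_def scaleR_sum_prod_def)
  ultimately have "((\<lambda>t. (?c t - SPair x (f x)) /\<^sub>R t) \<longlongrightarrow> SPair h v) (at_right 0)"
    by (rule Lim_transform_eventually)
  moreover have "\<forall>\<^sub>F t in at_right 0. ?c t \<in> gph f"
    by (auto simp: gph_def)
  ultimately show ?thesis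
    by (rule frechet_normal_velocity_le[OF normal])
qed

lemma has_dir_deriv_dir_deriv:
  assumes "dir_deriv_exists f x h"
  shows "has_dir_deriv f x h (dir_deriv f x h)"
proof -
  obtain v where v: "has_dir_deriv f x h v"
    using assms unfolding dir_deriv_exists_def by blast
  then have "dir_deriv f x h = v"
    unfolding dir_deriv_def has_dir_deriv_def
    by (intro the_equality) (auto dest: tendsto_unique[OF trivial_limit_at_right_real])
  with v show ?thesis by simp
qed

text \<open>Passing from \<open>p\<close> to \<open>q\<close> costs \<open>norm (q - p)\<close> on the left-hand side, because \<open>\<zeta>\<close> has norm 1, and
  \<open>\<epsilon> * norm (q - p)\<close> on the right-hand side.\<close>

lemma unit_functional_le_perturb:
  assumes unit: "norm \<zeta> = 1" and "0 \<le> \<epsilon>"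
    and p: "blinfun_apply \<zeta> p \<le> \<epsilon> * norm p"
  shows "blinfun_apply \<zeta> q \<le> \<epsilon> * norm q + (1 + \<epsilon>) * norm (q - p)"
proof -
  have "\<zeta> q = \<zeta> p + \<zeta> (q - p)"
    by (simp add: blinfun.diff_right)
  also have "\<dots> \<le> \<epsilon> * norm p + norm (q - p)"
    using p norm_blinfun[of \<zeta> "q - p"] unit by simp
  also have "\<dots> \<le> \<epsilon> * (norm q + norm (q - p)) + norm (q - p)"
    using norm_triangle_ineq3[of p q] \<open>0 \<le> \<epsilon>\<close>
    by (intro add_right_mono mult_left_mono) (auto simp: norm_minus_commute)
  finally show ?thesis
    by (simp add: algebra_simps)
qed

theorem proposition4p6:
  fixes f :: "'a::real_normed_vector \<Rightarrow> 'b::real_normed_vector" and xbar :: 'a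
  assumes "\<forall>\<^sub>F x in at xbar. dir_deriv_exists f x (x - xbar) \<and> dir_deriv_exists f x (xbar - x)"
    and "((\<lambda>x. max (norm (f x - f xbar - dir_deriv f x (x - xbar)))
                    (norm (f x - f xbar + dir_deriv f x (xbar - x)))
                / norm (SPair (f x - f xbar) (x - xbar))) \<longlongrightarrow> 0) (at xbar)"
  shows "semismooth_star f xbar"
proof -
  define zbar where "zbar = SPair xbar (f xbar)"
  have "\<exists>\<delta>>0. \<forall>z\<in>gph f. norm (z - zbar) < \<delta> \<longrightarrow>
      (\<forall>\<zeta>\<in>frechet_normals (gph f) \<delta> z. norm \<zeta> = 1 \<longrightarrow>
         \<bar>blinfun_apply \<zeta> (z - zbar)\<bar> \<le> \<epsilon> * norm (z - zbar))"
    if "0 < \<epsilon>" for \<epsilon> :: real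
  proof -
    \<comment> \<open>Chosen so that \<open>\<delta> + (1 + \<delta>) * e \<le> e + 2 * e \<le> \<epsilon>\<close> whenever \<open>\<delta> \<le> e\<close>.\<close>
    define e where "e = min 1 (\<epsilon> / 3)"
    have e: "0 < e" "e \<le> 1" "3 * e \<le> \<epsilon>"
      using that by (auto simp: e_def)
    have "\<forall>\<^sub>F x in at xbar. (dir_deriv_exists f x (x - xbar) \<and> dir_deriv_exists f x (xbar - x)) \<and>
        max (norm (f x - f xbar - dir_deriv f x (x - xbar)))
            (norm (f x - f xbar + dir_deriv f x (xbar - x)))
          / norm (SPair (f x - f xbar) (x - xbar)) < e"
      using assms(1) order_tendstoD(2)[OF assms(2) e(1)] by (rule eventually_conj)
    then obtain d where "0 < d" and near: "\<And>x. x \<noteq> xbar \<Longrightarrow> dist x xbar < d \<Longrightarrow>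
        (dir_deriv_exists f x (x - xbar) \<and> dir_deriv_exists f x (xbar - x)) \<and>
        max (norm (f x - f xbar - dir_deriv f x (x - xbar)))
            (norm (f x - f xbar + dir_deriv f x (xbar - x)))
          / norm (SPair (f x - f xbar) (x - xbar)) < e"
      unfolding eventually_at by auto
    define \<delta> where "\<delta> = min d e"
    have \<delta>: "0 < \<delta>" "\<delta> \<le> d" "\<delta> \<le> e"
      using \<open>0 < d\<close> e by (auto simp: \<delta>_def)
    have "\<bar>blinfun_apply \<zeta> (z - zbar)\<bar> \<le> \<epsilon> * norm (z - zbar)"
      if z: "z \<in> gph f" "norm (z - zbar) < \<delta>"
        and normal: "\<zeta> \<in> frechet_normals (gph f) \<delta> z" and unit: "norm \<zeta> = 1" for z \<zeta>
    proof -
      obtain x where x: "z = SPair x (f x)"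
        using z(1) by (auto simp: gph_def)
      define D where "D = z - zbar"
      have D: "D = SPair (x - xbar) (f x - f xbar)"
        by (simp add: D_def x zbar_def minus_sum_prod_def)
      show ?thesis
      proof (cases "x = xbar")
        case True
        then show ?thesis by (simp add: x zbar_def blinfun.zero_right)
      next
        case False
        let ?v = "dir_deriv f x (x - xbar)" and ?v' = "dir_deriv f x (xbar - x)"
        have normD: "norm D = norm (x - xbar) + norm (f x - f xbar)"
          by (simp add: D norm_sum_prod_def)
        have "dist x xbar < d"
          using z(2) \<delta>(2) normD norm_ge_zero[of "f x - f xbar"]
          unfolding D_def[symmetric] dist_norm by linarith
        note near_x = near[OF False this]
        have "0 < norm D"
          using False normD by (simp add: add_pos_nonneg)
        moreover have "norm (SPair (f x - f xbar) (x - xbar)) = norm D"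
          by (simp add: norm_sum_prod_def D add.commute)
        ultimately have err: "norm (f x - f xbar - ?v) \<le> e * norm D"
            "norm (f x - f xbar + ?v') \<le> e * norm D"
          using near_x by (auto simp: pos_divide_less_eq)
        have bound: "\<zeta> q \<le> \<epsilon> * norm D"
          if "norm q = norm D" and "has_dir_deriv f x h v" and "norm (q - SPair h v) \<le> e * norm D"
          for q h v
        proof -
          have "\<zeta> (SPair h v) \<le> \<delta> * norm (SPair h v)"
            using normal that(2) unfolding x by (rule frechet_normal_gph_le)
          then have "\<zeta> q \<le> \<delta> * norm q + (1 + \<delta>) * norm (q - SPair h v)"
            using unit \<delta>(1) by (intro unit_functional_le_perturb) auto
          also have "\<dots> \<le> e * norm D + 2 * (e * norm D)"
            using that(1,3) \<delta> e by (intro add_mono mult_mono) auto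
          also have "\<dots> = (3 * e) * norm D"
            by simp
          also have "\<dots> \<le> \<epsilon> * norm D"
            using e(3) by (rule mult_right_mono) simp
          finally show ?thesis .
        qed
        have "\<zeta> D \<le> \<epsilon> * norm D"
        proof (rule bound)
          show "has_dir_deriv f x (x - xbar) ?v"
            using near_x by (intro has_dir_deriv_dir_deriv) simp
          show "norm (D - SPair (x - xbar) ?v) \<le> e * norm D"
            using err(1) by (simp add: D norm_sum_prod_def minus_sum_prod_def)
        qed simp
        moreover have "\<zeta> (- D) \<le> \<epsilon> * norm D"
        proof (rule bound)
          show "has_dir_deriv f x (xbar - x) ?v'"
            using near_x by (intro has_dir_deriv_dir_deriv) simp
          have "- D - SPair (xbar - x) ?v' = - SPair 0 (f x - f xbar + ?v')"
            by (simp add: D minus_sum_prod_def uminus_sum_prod_def)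
          then have "norm (- D - SPair (xbar - x) ?v') = norm (SPair (0::'a) (f x - f xbar + ?v'))"
            by (simp only: norm_minus_cancel)
          then show "norm (- D - SPair (xbar - x) ?v') \<le> e * norm D"
            using err(2) by (simp add: norm_sum_prod_def)
        qed simp
        ultimately show ?thesis
          unfolding D_def[symmetric] by (simp add: blinfun.minus_right)
      qed
    qed
    then show ?thesis
      using \<delta>(1) by blast
  qed
  then show ?thesis
    by (auto simp: semismooth_star_def semismooth_star_set_def zbar_def gph_def)
qed

end
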